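(* Let $(X,d)$ be an infinite metric space and let $\mathfrak{B}$ be a bornology on $X$ with closed base, $X\notin\mathfrak{B}$. The following equalities hold (where an equality of two selection principles means that $X$ satisfies one if and only if it satisfies the other): (1) $S_1(\mathcal{O}_{\mathfrak{B}^s},\Gamma_{\mathfrak{B}^s})=S_{fin}(\mathcal{O}_{\mathfrak{B}^s},\Gamma_{\mathfrak{B}^s})$; (2) $S_1(\mathcal{O},\Gamma_{\mathfrak{B}^s})=S_{fin}(\mathcal{O},\Gamma_{\mathfrak{B}^s})$; (3) $S_1(\mathcal{O}_{\mathfrak{B}^s},\Gamma)=S_{fin}(\mathcal{O}_{\mathfrak{B}^s},\Gamma)$.
   Context: A bornology $\mathfrak{B}$ on $X$ is a family of subsets of $X$ that is closed under finite unions, hereditary (closed under taking subsets), and covers $X$. A base of $\mathfrak{B}$ is a subfamily of $\mathfrak{B}$ cofinal with respect to inclusion; it is closed if all its members are closed in $X$. For $B\in\mathfrak{B}$ and $\delta>0$, $B^\delta=\bigcup_{x\in B}\{y\in X: d(x,y)<\delta\}$. All open covers of $X$ are assumed to be countably infinite. $\mathcal{O}$ is the collection of all open covers of $X$. An open $\mathfrak{B}^s$-cover of $X$ is an open cover $\mathcal{U}$ with $X\notin\mathcal{U}$ such that for each $B\in\mathfrak{B}$ there are $U\in\mathcal{U}$ and $\delta>0$ with $B^\delta\subseteq U$; $\mathcal{O}_{\mathfrak{B}^s}$ is the collection of all of these. A $\gamma$-cover of $X$ is an infinite open cover $\mathcal{U}$ such that each $x\in X$ belongs to all but finitely many members of $\mathcal{U}$;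 $\Gamma$ is the collection of all $\gamma$-covers. A $\gamma_{\mathfrak{B}^s}$-cover of $X$ is an open cover $\mathcal{U}=\{U_n:n\in\mathbb{N}\}$ which is infinite and such that for each $B\in\mathfrak{B}$ there are $n_0\in\mathbb{N}$ and a sequence $\{\delta_n:n\ge n_0\}$ of positive reals with $B^{\delta_n}\subseteq U_n$ for all $n\ge n_0$; $\Gamma_{\mathfrak{B}^s}$ is the collection of all of these. $S_1(\mathcal{A},\mathcal{C})$: for each sequence $\{A_n:n\in\mathbb{N}\}$ of elements of $\mathcal{A}$ there is a sequence $\{b_n:n\in\mathbb{N}\}$ with $b_n\in A_n$ for each $n$ and $\{b_n:n\in\mathbb{N}\}\in\mathcal{C}$. $S_{fin}(\mathcal{A},\mathcal{C})$: for each sequence $\{A_n:n\in\mathbb{N}\}$ of elements of $\mathcal{A}$ there is a sequence $\{B_n:n\in\mathbb{N}\}$ of finite (possibly empty) sets with $B_n\subseteq A_n$ for each $n$ and $\bigcup_{n}B_n\in\mathcal{C}$. *)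

theory Defs
  imports "HOL-Analysis.Elementary_Metric_Spaces"
begin

text \<open>
  The metric space \<open>X\<close> is the universe of a type \<open>'a\<close> of class \<^class>\<open>metric_space\<close>,
  so that ``\<open>X \<notin> \<BB>\<close>'' is \<open>UNIV \<notin> \<BB>\<close>.
\<close>

definition bornology :: "'a set set \<Rightarrow> bool" where
  "bornology \<BB> \<longleftrightarrow>
     (\<forall>\<F>. finite \<F> \<and> \<F> \<subseteq> \<BB> \<longrightarrow> \<Union>\<F> \<in> \<BB>) \<and>
     (\<forall>B\<in>\<BB>. \<forall>A. A \<subseteq> B \<longrightarrow> A \<in> \<BB>) \<and>
     \<Union>\<BB> = UNIV"

definition bornology_base :: "'a set set \<Rightarrow> 'a set set \<Rightarrow> bool" where
  "bornology_base \<BB> \<BB>\<^sub>0 \<longleftrightarrow> \<BB>\<^sub>0 \<subseteq> \<BB> \<and> (\<forall>B\<in>\<BB>. \<exists>B\<^sub>0\<in>\<BB>\<^sub>0. B \<subseteq> B\<^sub>0)"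

definition has_closed_base :: "'a::topological_space set set \<Rightarrow> bool" where
  "has_closed_base \<BB> \<longleftrightarrow> (\<exists>\<BB>\<^sub>0. bornology_base \<BB> \<BB>\<^sub>0 \<and> (\<forall>B\<in>\<BB>\<^sub>0. closed B))"

definition enlargement :: "'a::metric_space set \<Rightarrow> real \<Rightarrow> 'a set" where
  "enlargement B \<delta> = (\<Union>x\<in>B. ball x \<delta>)"

text \<open>By convention, every open cover is countably infinite.\<close>

definition open_covers :: "'a::topological_space set set set" where
  "open_covers =
     {\<U>. (\<forall>U\<in>\<U>. open U) \<and> \<Union>\<U> = UNIV \<and> countable \<U> \<and> infinite \<U>}"

definition open_Bs_covers :: "'a::metric_space set set \<Rightarrow> 'a set set set" where
  "open_Bs_covers \<BB> =
     {\<U> \<in> open_covers. UNIV \<notin> \<U> \<and>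
        (\<forall>B\<in>\<BB>. \<exists>U\<in>\<U>. \<exists>\<delta>>0. enlargement B \<delta> \<subseteq> U)}"

definition gamma_covers :: "'a::topological_space set set set" where
  "gamma_covers = {\<U> \<in> open_covers. infinite \<U> \<and> (\<forall>x. finite {U \<in> \<U>. x \<notin> U})}"

text \<open>
  A \<open>\<gamma>\<close>-cover relative to \<open>\<BB>\<close> is a family of sets admitting an enumeration (repetitions are
  allowed) with the stated property. The members are not required to differ from the whole space.
\<close>

definition gamma_Bs_covers :: "'a::metric_space set set \<Rightarrow> 'a set set set" where
  "gamma_Bs_covers \<BB> =
     {\<U> \<in> open_covers. infinite \<U> \<and>
        (\<exists>U :: nat \<Rightarrow> 'a set. \<U> = range U \<and>
           (\<forall>B\<in>\<BB>. \<exists>n\<^sub>0. \<exists>\<delta> :: nat \<Rightarrow> real. \<forall>n\<ge>n\<^sub>0. \<delta> n > 0 \<and> enlargement B (\<delta> n) \<subseteq> U n))}"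

definition S1 :: "'b set set \<Rightarrow> 'b set set \<Rightarrow> bool" where
  "S1 \<A> \<C> \<longleftrightarrow>
     (\<forall>A :: nat \<Rightarrow> 'b set. (\<forall>n. A n \<in> \<A>) \<longrightarrow>
        (\<exists>b :: nat \<Rightarrow> 'b. (\<forall>n. b n \<in> A n) \<and> range b \<in> \<C>))"

definition Sfin :: "'b set set \<Rightarrow> 'b set set \<Rightarrow> bool" where
  "Sfin \<A> \<C> \<longleftrightarrow>
     (\<forall>A :: nat \<Rightarrow> 'b set. (\<forall>n. A n \<in> \<A>) \<longrightarrow>
        (\<exists>B :: nat \<Rightarrow> 'b set. (\<forall>n. finite (B n) \<and> B n \<subseteq> A n) \<and> (\<Union>n. B n) \<in> \<C>))"

end

theory Submission
  imports Defs
begin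

text \<open>
  Selecting single members is a special case of selecting finite sets, so only the passage from
  \<open>Sfin\<close> to \<open>S1\<close> needs an argument.

  When the given covers \<open>A n\<close> are \<open>\<BB>\<^sup>s\<close>-covers, replace them by their successive common refinements
  \<open>V n\<close>, whose members are the intersections of one member from each of \<open>A 0, \<dots>, A n\<close>. These are
  again \<open>\<BB>\<^sup>s\<close>-covers; in particular they are infinite, because a finite family of proper subsets of
  the space cannot have, for each finite set, a member containing it. Let \<open>Sfin\<close> select finite sets \<open>W n\<close> from
  the \<open>V n\<close>. Their union is infinite, so some member \<open>G n\<close> of it lies outside
  \<open>W 0, \<dots>, W (n - 1)\<close>. This \<open>G n\<close> belongs to some \<open>V m\<close> with \<open>m \<ge> n\<close> and is thus contained in some
  \<open>b n \<in> A n\<close>. Each set occurs only finitely often among the \<open>G n\<close>, so the sequence \<open>G\<close> inherits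
  the \<open>\<gamma>\<close>-property, which then passes to the larger sets \<open>b n\<close>. Finally the \<open>b n\<close> form an infinite
  family: a set repeated infinitely often would have to be the whole space. The lemma
  \<open>Sfin_imp_S1_open_Bs_covers\<close> carries this out for a target \<open>gamma_Bs_covers \<C>\<close> in which \<open>\<C>\<close> may
  differ from \<open>\<BB>\<close>. Taking \<open>\<C> = \<BB>\<close> settles the target \<open>gamma_Bs_covers \<BB>\<close>, and letting \<open>\<C>\<close>
  consist of the singletons settles \<open>gamma_covers\<close>, since the classical \<open>\<gamma>\<close>-covers are the \<open>\<gamma>\<close>-covers relative to the singletons.

  For arbitrary open covers, both principles fail. An infinite metric space has an infinite
  countable open cover each of whose members misses one of two fixed points \<open>p\<close> and \<open>q\<close>; as
  \<open>{p, q} \<in> \<BB>\<close>, no subfamily of it is a \<open>\<gamma>\<close>-cover relative to \<open>\<BB>\<close>. The middle equivalence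
  therefore holds because both of its sides are false.
\<close>

section \<open>Containing an enlargement\<close>

definition strongly_contained :: "'a::metric_space set \<Rightarrow> 'a set \<Rightarrow> bool" where
  "strongly_contained B U \<longleftrightarrow> (\<exists>\<delta>>0. enlargement B \<delta> \<subseteq> U)"

lemma strongly_containedD: "strongly_contained B U \<Longrightarrow> B \<subseteq> U"
  unfolding strongly_contained_def enlargement_def by force

lemma strongly_contained_mono:
  "strongly_contained B U \<Longrightarrow> U \<subseteq> V \<Longrightarrow> strongly_contained B V"
  unfolding strongly_contained_def by blast

lemma strongly_contained_Int:
  assumes "strongly_contained B U" "strongly_contained B V"
  shows "strongly_contained B (U \<inter> V)"
proof -
  obtain d e where "d > 0" "enlargement B d \<subseteq> U" "e > 0" "enlargement B e \<subseteq> V"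
    using assms unfolding strongly_contained_def by blast
  then have "min d e > 0" "enlargement B (min d e) \<subseteq> U \<inter> V"
    unfolding enlargement_def by force+
  then show ?thesis
    unfolding strongly_contained_def by blast
qed

lemma strongly_contained_singleton:
  assumes "open U"
  shows "strongly_contained {x} U \<longleftrightarrow> x \<in> U"
  using assms strongly_containedD[of "{x}" U]
  unfolding strongly_contained_def enlargement_def by (auto simp: open_contains_ball)

section \<open>Covers relative to a family of sets\<close>

lemma bornology_finite:
  assumes "bornology \<BB>" "finite F"
  shows "F \<in> \<BB>"
proof -
  have "{x} \<in> \<BB>" for x
  proof -
    obtain B where "B \<in> \<BB>" "x \<in> B"
      using assms(1) unfolding bornology_def by blast
    then show ?thesis
      using assms(1) unfolding bornology_def by (metis empty_subsetI insert_subset)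
  qed
  then have "finite ((\<lambda>x. {x}) ` F)" "(\<lambda>x. {x}) ` F \<subseteq> \<BB>"
    using assms(2) by auto
  then have "\<Union> ((\<lambda>x. {x}) ` F) \<in> \<BB>"
    using assms(1) unfolding bornology_def by blast
  then show ?thesis by simp
qed

lemma open_Bs_covers_iff:
  "\<U> \<in> open_Bs_covers \<BB> \<longleftrightarrow>
     \<U> \<in> open_covers \<and> UNIV \<notin> \<U> \<and> (\<forall>B\<in>\<BB>. \<exists>U\<in>\<U>. strongly_contained B U)"
  unfolding open_Bs_covers_def strongly_contained_def by simp

text \<open>
  The radii in the definition of \<open>gamma_Bs_covers\<close> may depend on the index, so they carry no
  uniformity and can be hidden in \<open>strongly_contained\<close>.
\<close>

lemma gamma_Bs_covers_iff:
  "\<U> \<in> gamma_Bs_covers \<C> \<longleftrightarrow>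
     \<U> \<in> open_covers \<and>
     (\<exists>U :: nat \<Rightarrow> 'a::metric_space set. \<U> = range U \<and>
        (\<forall>B\<in>\<C>. eventually (\<lambda>n. strongly_contained B (U n)) sequentially))"
proof -
  have "(\<exists>\<delta> :: nat \<Rightarrow> real. \<forall>n\<ge>n0. \<delta> n > 0 \<and> enlargement B (\<delta> n) \<subseteq> U n) \<longleftrightarrow>
      (\<forall>n\<ge>n0. strongly_contained B (U n))" for B :: "'a set" and U n0
    unfolding strongly_contained_def by metis
  then show ?thesis
    unfolding gamma_Bs_covers_def eventually_sequentially by (auto simp: open_covers_def)
qed

lemma gamma_Bs_covers_finite_exceptions:
  assumes "\<U> \<in> gamma_Bs_covers \<C>" "B \<in> \<C>"
  shows "finite {U \<in> \<U>. \<not> strongly_contained B U}"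
proof -
  obtain U :: "nat \<Rightarrow> _" and n0 where "\<U> = range U" "\<forall>n\<ge>n0. strongly_contained B (U n)"
    using assms unfolding gamma_Bs_covers_iff eventually_sequentially by blast
  then have "{U \<in> \<U>. \<not> strongly_contained B U} \<subseteq> U ` {..<n0}"
    by (auto simp: not_less[symmetric])
  then show ?thesis
    by (rule finite_subset) simp
qed

text \<open>
  Finitely many exceptional members become finitely many exceptional indices when the family is
  enumerated without repetitions.
\<close>

lemma gamma_covers_eq_gamma_Bs_covers_singletons:
  "(gamma_covers :: 'a::metric_space set set set) = gamma_Bs_covers (range (\<lambda>x. {x}))"
proof (intro equalityI subsetI)
  fix \<U> :: "'a set set"
  assume \<U>: "\<U> \<in> gamma_covers"
  then have cover: "\<U> \<in> open_covers" and "countable \<U>" "infinite \<U>"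
    by (auto simp: gamma_covers_def open_covers_def)
  then have bij: "bij_betw (from_nat_into \<U>) UNIV \<U>"
    by (rule_tac bij_betw_from_nat_into)
  let ?U = "from_nat_into \<U>"
  have "eventually (\<lambda>n. strongly_contained {x} (?U n)) sequentially" for x
  proof -
    have "finite {U \<in> \<U>. x \<notin> U}"
      using \<U> by (simp add: gamma_covers_def)
    then have "finite (?U -` {U \<in> \<U>. x \<notin> U})"
      using bij by (intro finite_vimageI) (auto simp: bij_betw_def)
    moreover have "{n. \<not> strongly_contained {x} (?U n)} \<subseteq> ?U -` {U \<in> \<U>. x \<notin> U}"
    proof -
      have "?U n \<in> \<U>" for n
        using bij by (auto simp: bij_betw_def)
      then show ?thesis
        using cover strongly_contained_singleton by (auto simp: open_covers_def)
    qed
    ultimately have "finite {n. \<not> strongly_contained {x} (?U n)}"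
      by (rule rev_finite_subset)
    then show ?thesis
      by (simp add: eventually_cofinite flip: cofinite_eq_sequentially)
  qed
  then show "\<U> \<in> gamma_Bs_covers (range (\<lambda>x. {x}))"
    using cover bij unfolding gamma_Bs_covers_iff bij_betw_def by blast
next
  fix \<U> :: "'a set set"
  assume \<U>: "\<U> \<in> gamma_Bs_covers (range (\<lambda>x. {x}))"
  then have cover: "\<U> \<in> open_covers"
    by (simp add: gamma_Bs_covers_iff)
  have "finite {U \<in> \<U>. x \<notin> U}" for x
  proof -
    have "{U \<in> \<U>. x \<notin> U} \<subseteq> {U \<in> \<U>. \<not> strongly_contained {x} U}"
      using strongly_containedD by auto
    then show ?thesis
      using gamma_Bs_covers_finite_exceptions[OF \<U>] finite_subset by blast
  qed
  then show "\<U> \<in> gamma_covers"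
    using cover by (auto simp: gamma_covers_def open_covers_def)
qed

section \<open>Common refinements\<close>

definition meet :: "'a set set \<Rightarrow> 'a set set \<Rightarrow> 'a set set" where
  "meet \<U> \<V> = (\<lambda>(U, V). U \<inter> V) ` (\<U> \<times> \<V>)"

primrec meets :: "(nat \<Rightarrow> 'a set set) \<Rightarrow> nat \<Rightarrow> 'a set set" where
  "meets A 0 = A 0"
| "meets A (Suc n) = meet (meets A n) (A (Suc n))"

text \<open>
  If each member \<open>U\<close> of a finite family omits a point \<open>x U\<close>, then no member contains the finite
  set of these points.
\<close>

lemma infinite_if_contains_finite_sets:
  assumes "UNIV \<notin> \<U>" and "\<And>F. finite F \<Longrightarrow> \<exists>U\<in>\<U>. F \<subseteq> U"
  shows "infinite \<U>"
proof
  assume "finite \<U>"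
  have "\<forall>U\<in>\<U>. \<exists>x. x \<notin> U"
    using assms(1) by (metis UNIV_eq_I)
  then obtain x where x: "\<forall>U\<in>\<U>. x U \<notin> U"
    by metis
  show False
    using assms(2)[of "x ` \<U>"] \<open>finite \<U>\<close> x by auto
qed

lemma meet_open_Bs_covers:
  assumes \<BB>: "bornology \<BB>"
    and \<U>: "\<U> \<in> open_Bs_covers \<BB>" and \<V>: "\<V> \<in> open_Bs_covers \<BB>"
  shows "meet \<U> \<V> \<in> open_Bs_covers \<BB>"
proof -
  have contained: "\<exists>W\<in>meet \<U> \<V>. strongly_contained B W" if "B \<in> \<BB>" for B
    using \<U> \<V> that strongly_contained_Int unfolding open_Bs_covers_iff meet_def by fastforce
  have proper: "UNIV \<notin> meet \<U> \<V>"
    using \<U> unfolding open_Bs_covers_iff meet_def by auto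
  have "infinite (meet \<U> \<V>)"
    using proper
  proof (rule infinite_if_contains_finite_sets)
    fix F :: "'a set"
    assume "finite F"
    then obtain W where "W \<in> meet \<U> \<V>" "strongly_contained F W"
      using contained bornology_finite[OF \<BB>] by metis
    then show "\<exists>W\<in>meet \<U> \<V>. F \<subseteq> W"
      using strongly_containedD by metis
  qed
  moreover have "countable (meet \<U> \<V>)" "\<forall>W\<in>meet \<U> \<V>. open W"
    using \<U> \<V> by (auto simp: open_Bs_covers_iff open_covers_def meet_def)
  moreover have "\<Union>(meet \<U> \<V>) = UNIV"
  proof -
    have "\<Union>(meet \<U> \<V>) = \<Union>\<U> \<inter> \<Union>\<V>"
      by (auto simp: meet_def)
    then show ?thesis
      using \<U> \<V> by (simp add: open_Bs_covers_iff open_covers_def)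
  qed
  ultimately show ?thesis
    using contained proper by (simp add: open_Bs_covers_iff open_covers_def)
qed

lemma meets_open_Bs_covers:
  assumes "bornology \<BB>" "\<And>n. A n \<in> open_Bs_covers \<BB>"
  shows "meets A n \<in> open_Bs_covers \<BB>"
  by (induction n) (simp_all add: assms meet_open_Bs_covers)

lemma meets_refines:
  assumes "m \<le> n" "V \<in> meets A n"
  shows "\<exists>U\<in>A m. V \<subseteq> U"
  using assms
proof (induction n arbitrary: V)
  case 0
  then show ?case by auto
next
  case (Suc n)
  then obtain V' U where V: "V' \<in> meets A n" "U \<in> A (Suc n)" "V = V' \<inter> U"
    by (auto simp: meet_def)
  show ?case
  proof (cases "m = Suc n")
    case True
    then show ?thesis
      using V by auto
  next
    case False
    then have "\<exists>U\<in>A m. V' \<subseteq> U"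
      using Suc.IH[OF _ V(1)] Suc.prems(1) by simp
    then show ?thesis
      using V(3) by auto
  qed
qed

section \<open>Selection principles\<close>

lemma S1_imp_Sfin:
  assumes "S1 \<A> \<C>"
  shows "Sfin \<A> \<C>"
  unfolding Sfin_def
proof (intro allI impI)
  fix A :: "nat \<Rightarrow> _"
  assume "\<forall>n. A n \<in> \<A>"
  then obtain b where "\<forall>n. b n \<in> A n" "range b \<in> \<C>"
    using assms unfolding S1_def by blast
  moreover have "(\<Union>n. {b n}) = range b"
    by auto
  ultimately show "\<exists>B. (\<forall>n. finite (B n) \<and> B n \<subseteq> A n) \<and> (\<Union>n. B n) \<in> \<C>"
    by (intro exI[of _ "\<lambda>n. {b n}"]) simp
qed

text \<open>
  Avoiding the first \<open>n\<close> finite sets at stage \<open>n\<close> makes every value occur only finitely often,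
  hence any property of all but finitely many members holds eventually along the sequence.
\<close>

lemma sequence_escaping_finite_sets:
  assumes "\<And>n. finite (W n)" "infinite (\<Union>n::nat. W n)"
  obtains G where
    "\<And>n. \<exists>m\<ge>n. G n \<in> W m"
    "\<And>P. finite {g \<in> (\<Union>n. W n). \<not> P g} \<Longrightarrow> eventually (\<lambda>n. P (G n)) sequentially"
proof -
  have "\<exists>g. g \<in> (\<Union>n. W n) - (\<Union>k<n. W k)" for n
  proof -
    have "infinite ((\<Union>n. W n) - (\<Union>k<n. W k))"
      using assms by (intro Diff_infinite_finite) auto
    then show ?thesis
      using infinite_imp_nonempty by blast
  qed
  then obtain G where G: "\<And>n. G n \<in> (\<Union>n. W n) - (\<Union>k<n. W k)"
    by metis
  show thesis
  proof
    fix n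
    obtain m where "G n \<in> W m"
      using G[of n] by auto
    moreover have "m \<ge> n"
      using G[of n] \<open>G n \<in> W m\<close> by (force simp: not_less[symmetric])
    ultimately show "\<exists>m\<ge>n. G n \<in> W m"
      by blast
  next
    fix P
    assume exceptions: "finite {g \<in> (\<Union>n. W n). \<not> P g}"
    have "eventually (\<lambda>n. G n \<noteq> g) sequentially" if g: "g \<in> (\<Union>n. W n)" for g
    proof -
      obtain k where "g \<in> W k"
        using g by auto
      then have "G n \<noteq> g" if "n \<ge> Suc k" for n
        using G[of n] that by auto
      then show ?thesis
        unfolding eventually_sequentially by blast
    qed
    then have "\<forall>g\<in>{g \<in> (\<Union>n. W n). \<not> P g}. eventually (\<lambda>n. G n \<noteq> g) sequentially"
      by blast
    with exceptions
    have "eventually (\<lambda>n. \<forall>g\<in>{g \<in> (\<Union>n. W n). \<not> P g}. G n \<noteq> g) sequentially"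
      by (rule eventually_ball_finite)
    then show "eventually (\<lambda>n. P (G n)) sequentially"
      by (rule eventually_mono) (use G in blast)
  qed
qed

text \<open>
  Properness of the sets forces infinitely many distinct ones: a set attained infinitely often
  would contain every member of the covering family \<open>\<C>\<close>.
\<close>

lemma range_in_gamma_Bs_covers:
  fixes b :: "nat \<Rightarrow> 'a::metric_space set"
  assumes \<C>: "\<Union>\<C> = UNIV"
    and "\<And>n. open (b n)" and proper: "\<And>n. b n \<noteq> UNIV"
    and ev: "\<And>B. B \<in> \<C> \<Longrightarrow> eventually (\<lambda>n. strongly_contained B (b n)) sequentially"
  shows "range b \<in> gamma_Bs_covers \<C>"
proof -
  have point: "eventually (\<lambda>n. x \<in> b n) sequentially" for x
  proof -
    obtain B where "B \<in> \<C>" "x \<in> B"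
      using \<C> by blast
    then show ?thesis
      using ev[of B] by (auto elim!: eventually_mono dest: strongly_containedD)
  qed
  have "infinite (range b)"
  proof
    assume "finite (range b)"
    then obtain k where "infinite {n. b n = b k}"
      using pigeonhole_infinite[of "UNIV :: nat set" b] by auto
    then have often: "frequently (\<lambda>n. b n = b k) sequentially"
      by (simp add: frequently_cofinite flip: cofinite_eq_sequentially)
    have "x \<in> b k" for x
      using frequently_eventually_frequently[OF often point[of x]]
      by (auto dest!: frequently_ex)
    then show False
      using proper[of k] by blast
  qed
  moreover have "\<Union>(range b) = UNIV"
    using point eventually_happens'[OF sequentially_bot] by blast
  ultimately show ?thesis
    using assms unfolding gamma_Bs_covers_iff open_covers_def by auto
qed

lemma Sfin_imp_S1_open_Bs_covers:
  fixes \<BB> \<C> :: "'a::metric_space set set"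
  assumes \<BB>: "bornology \<BB>" and \<C>: "\<Union>\<C> = UNIV"
    and Sfin: "Sfin (open_Bs_covers \<BB>) (gamma_Bs_covers \<C>)"
  shows "S1 (open_Bs_covers \<BB>) (gamma_Bs_covers \<C>)"
  unfolding S1_def
proof (intro allI impI)
  fix A :: "nat \<Rightarrow> 'a set set"
  assume A: "\<forall>n. A n \<in> open_Bs_covers \<BB>"
  then have "\<forall>n. meets A n \<in> open_Bs_covers \<BB>"
    using meets_open_Bs_covers[OF \<BB>] by blast
  then obtain W where W: "\<forall>n. finite (W n) \<and> W n \<subseteq> meets A n"
      and gamma: "(\<Union>n. W n) \<in> gamma_Bs_covers \<C>"
    using Sfin unfolding Sfin_def by blast
  have "infinite (\<Union>n. W n)"
    using gamma by (auto simp: gamma_Bs_covers_iff open_covers_def)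
  then obtain G where late: "\<And>n. \<exists>m\<ge>n. G n \<in> W m"
    and eventually_G:
      "\<And>P. finite {g \<in> (\<Union>n. W n). \<not> P g} \<Longrightarrow> eventually (\<lambda>n. P (G n)) sequentially"
    using sequence_escaping_finite_sets[of W] W by blast
  have "\<exists>U\<in>A n. G n \<subseteq> U" for n
    using late[of n] W meets_refines by blast
  then obtain b where b: "\<And>n. b n \<in> A n" "\<And>n. G n \<subseteq> b n"
    by metis
  have "range b \<in> gamma_Bs_covers \<C>"
    using \<C>
  proof (rule range_in_gamma_Bs_covers)
    show "open (b n)" "b n \<noteq> UNIV" for n
      using A b(1)[of n] by (auto simp: open_Bs_covers_iff open_covers_def)
    show "eventually (\<lambda>n. strongly_contained B (b n)) sequentially" if "B \<in> \<C>" for B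
      using eventually_G[OF gamma_Bs_covers_finite_exceptions[OF gamma that]]
      by (rule eventually_mono) (use b(2) strongly_contained_mono in blast)
  qed
  then show "\<exists>b. (\<forall>n. b n \<in> A n) \<and> range b \<in> gamma_Bs_covers \<C>"
    using b(1) by blast
qed

text \<open>
  The complements of \<open>{p}\<close> and \<open>{q}\<close> already cover the space; the sets \<open>- {p, f n}\<close> are added to
  make the cover infinite while every member still misses \<open>p\<close> or \<open>q\<close>.
\<close>

lemma not_Sfin_open_covers:
  fixes \<BB> :: "'a::metric_space set set"
  assumes "infinite (UNIV :: 'a set)" and \<BB>: "bornology \<BB>"
  shows "\<not> Sfin (open_covers :: 'a set set set) (gamma_Bs_covers \<BB>)"
proof
  assume Sfin: "Sfin (open_covers :: 'a set set set) (gamma_Bs_covers \<BB>)"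
  obtain f :: "nat \<Rightarrow> 'a" where "inj f"
    using infinite_countable_subset[OF assms(1)] by auto
  define p q where "p = f 0" and "q = f 1"
  have "p \<noteq> q"
    using \<open>inj f\<close> by (auto simp: p_def q_def dest: injD)
  define \<U> where "\<U> = insert (- {q}) (range (\<lambda>n. - {p, f n}))"
  have "inj (\<lambda>n. - {p, f n})"
  proof (rule injI)
    fix m n
    assume "- {p, f m} = - {p, f n}"
    then have "{p, f m} = {p, f n}"
      by blast
    then have "f m = f n"
      by (auto simp: doubleton_eq_iff)
    then show "m = n"
      using \<open>inj f\<close> by (auto dest: injD)
  qed
  then have "infinite \<U>"
    unfolding \<U>_def by (simp add: finite_image_iff)
  moreover have "\<Union>\<U> = UNIV"
  proof -
    \<comment> \<open>As \<open>p = f 0\<close>, the index \<open>0\<close> contributes the complement of \<open>p\<close>.\<close>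
    have "- {p} \<in> \<U>"
      unfolding \<U>_def p_def by (intro insertI2 range_eqI[of _ _ 0]) simp
    moreover have "- {q} \<in> \<U>"
      by (simp add: \<U>_def)
    ultimately show ?thesis
      using \<open>p \<noteq> q\<close> by blast
  qed
  moreover have "\<forall>U\<in>\<U>. open U"
    by (auto simp: \<U>_def intro!: open_Compl finite_imp_closed)
  ultimately have "\<U> \<in> open_covers"
    by (simp add: open_covers_def \<U>_def)
  then obtain W :: "nat \<Rightarrow> _" where "\<forall>n. W n \<subseteq> \<U>" and gamma: "(\<Union>n. W n) \<in> gamma_Bs_covers \<BB>"
    using Sfin[unfolded Sfin_def, rule_format, of "\<lambda>_. \<U>"] by blast
  have "{p, q} \<in> \<BB>"
    using bornology_finite[OF \<BB>] by simp
  then obtain U where "(\<Union>n. W n) = range U"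
      and ev: "eventually (\<lambda>n. strongly_contained {p, q} (U n)) sequentially"
    using gamma unfolding gamma_Bs_covers_iff by blast
  obtain n :: nat where "strongly_contained {p, q} (U n)"
    using eventually_happens'[OF sequentially_bot ev] by blast
  then have "{p, q} \<subseteq> U n"
    by (rule strongly_containedD)
  moreover have "U n \<in> \<U>"
    using \<open>(\<Union>n. W n) = range U\<close> \<open>\<forall>n. W n \<subseteq> \<U>\<close> by blast
  ultimately show False
    by (auto simp: \<U>_def)
qed

theorem theorem3p2:
  fixes \<BB> :: "'a::metric_space set set"
  assumes "infinite (UNIV :: 'a set)"
    and "bornology \<BB>"
    and "has_closed_base \<BB>"
    and "UNIV \<notin> \<BB>"
  shows "(S1 (open_Bs_covers \<BB>) (gamma_Bs_covers \<BB>) \<longleftrightarrow> Sfin (open_Bs_covers \<BB>) (gamma_Bs_covers \<BB>)) \<and>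
         (S1 (open_covers :: 'a set set set) (gamma_Bs_covers \<BB>) \<longleftrightarrow> Sfin (open_covers :: 'a set set set) (gamma_Bs_covers \<BB>)) \<and>
         (S1 (open_Bs_covers \<BB>) (gamma_covers :: 'a set set set) \<longleftrightarrow> Sfin (open_Bs_covers \<BB>) (gamma_covers :: 'a set set set))"
proof (intro conjI)
  have "\<Union>\<BB> = UNIV"
    using assms(2) by (simp add: bornology_def)
  then show "S1 (open_Bs_covers \<BB>) (gamma_Bs_covers \<BB>) \<longleftrightarrow>
      Sfin (open_Bs_covers \<BB>) (gamma_Bs_covers \<BB>)"
    using S1_imp_Sfin Sfin_imp_S1_open_Bs_covers[OF assms(2)] by blast
  show "S1 (open_covers :: 'a set set set) (gamma_Bs_covers \<BB>) \<longleftrightarrow>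
      Sfin (open_covers :: 'a set set set) (gamma_Bs_covers \<BB>)"
    using S1_imp_Sfin not_Sfin_open_covers[OF assms(1,2)] by blast
  have "\<Union>(range (\<lambda>x::'a. {x})) = UNIV"
    by auto
  then show "S1 (open_Bs_covers \<BB>) (gamma_covers :: 'a set set set) \<longleftrightarrow>
      Sfin (open_Bs_covers \<BB>) (gamma_covers :: 'a set set set)"
    unfolding gamma_covers_eq_gamma_Bs_covers_singletons
    using S1_imp_Sfin Sfin_imp_S1_open_Bs_covers[OF assms(2)] by blast
qed

end
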